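(* Let $n,m,T$ be positive integers, let $A\in\mathbb{R}^{n\times n}$, $B\in\mathbb{R}^{n\times m}$ be such that the pair $(A,B)$ is controllable, and let $\delta>0$. Let $\rho>0$ and suppose that $\sigma_1(\Theta_z)\geq\rho$ for every vector $z=(\xi,\eta,0_{nm})$ with $\xi\in\mathbb{R}^n$, $\eta\in\mathbb{R}^m$ and $\|z\|=1$. Let $(u_{[0,T-1]},x_{[0,T-1]})$ be an input/state trajectory of the system $x(t+1)=Ax(t)+Bu(t)$ such that $u_{[0,T-1]}$ is $\delta\frac{\sqrt{n+1}}{\rho}$-persistently exciting of order $n+1$. Then $$\sigma_1\left(\begin{bmatrix}\mathcal{H}_1(x_{[0,T-1]})\\ \mathcal{H}_1(u_{[0,T-1]})\end{bmatrix}\right)\geq\delta .$$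
   Context: **Singular values.** For a real matrix $M$ of size $p\times q$, the singular values are indexed in increasing order, $0\leq\sigma_1(M)\leq\sigma_2(M)\leq\cdots\leq\sigma_{\min\{p,q\}}(M)$; thus $\sigma_1(M)$ is the smallest of the $\min\{p,q\}$ singular values. $\|\cdot\|$ is the Euclidean norm on vectors. **Hankel matrices.** For integers $0\le i\le j$ and a sequence of vectors $z(i),\dots,z(j)$, write $z_{[i,j]}=[z(i)^\top\; z(i+1)^\top\cdots z(j)^\top]^\top$. For a positive integer $k\leq j-i+1$, the Hankel matrix of depth $k$ is $$\mathcal{H}_k(z_{[i,j]})=\begin{bmatrix} z(i)&z(i+1)&\cdots&z(j-k+1)\\ z(i+1)&z(i+2)&\cdots&z(j-k+2)\\ \vdots&\vdots&\ddots&\vdots\\ z(i+k-1)&z(i+k)&\cdots&z(j)\end{bmatrix}.$$ In particular $\mathcal{H}_1(x_{[0,T-1]})=[x(0)\;x(1)\cdots x(T-1)]$ and $\mathcal{H}_1(u_{[0,T-1]})=[u(0)\;u(1)\cdots u(T-1)]$. **Trajectory.** Here $x(t)\in\mathbb{R}^n$ is the state and $u(t)\in\mathbb{R}^m$ the input; $(u_{[0,T-1]},x_{[0,T-1]})$ is an input/state trajectory if $x(t+1)=Ax(t)+Bu(t)$ for $t=0,\dots,T-2$ (with arbitrary $x(0)$). **$\alpha$-persistency of excitation.** For $\alpha>0$ and a positive integer $k$, an input sequence $u_{[0,T-1]}$ is called $\alpha$-persistently exciting of order $k$ if $\sigma_1(\mathcal{H}_k(u_{[0,T-1]}))\geq\alpha$.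 **The matrix $\Theta_z$.** Let $M$ be the square matrix of size $n+(n+1)m$, with block rows and columns of sizes $n,m,\dots,m$ ($n+1$ blocks of size $m$), $$M=\begin{bmatrix}A&B&0&\cdots&0\\0&0&I_m&\cdots&0\\ \vdots&\vdots&\vdots&\ddots&\vdots\\0&0&0&\cdots&I_m\\0&0&0&\cdots&0\end{bmatrix},$$ where $I_m$ is the $m\times m$ identity matrix, and, for $z=(\xi,\eta,0_{nm})\in\mathbb{R}^{n+m+nm}$ (column vector, with $0_{nm}$ the zero vector of length $nm$), $$\Theta_z=\begin{bmatrix}z&M^\top z&\cdots&(M^\top)^n z\end{bmatrix}^\top\in\mathbb{R}^{(n+1)\times(n+(n+1)m)}.$$
   Formalization: Adds the hypothesis T ≥ n+(n+1)m, so that the depth-(n+1) Hankel matrix of the input is at least as wide as tall; without it the claim fails, e.g. n=m=1, T=2, A=0, B=1, x=0, u(0)=0, u(1)=c large. *)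

theory Defs
  imports
    "HOL-Computational_Algebra.Fundamental_Theorem_Algebra"
    "Jordan_Normal_Form.Char_Poly"
begin

definition euclidean_norm :: "real vec \<Rightarrow> real" where
  "euclidean_norm v = sqrt (v \<bullet> v)"

text \<open>
  The \<open>min p q\<close> singular values of a \<open>p \<times> q\<close> matrix, in increasing order: the square roots of
  the eigenvalues, repeated according to multiplicity, of the smaller of the two Gram matrices
  \<open>M M\<^sup>T\<close> and \<open>M\<^sup>T M\<close>. The larger one has the same eigenvalues together with
  \<open>\<bar>p - q\<bar>\<close> further zeros, which are not singular values.
\<close>

definition gram_mat :: "real mat \<Rightarrow> real mat" where
  "gram_mat M = (if dim_row M \<le> dim_col M then M * transpose_mat M else transpose_mat M * M)"

definition singular_values :: "real mat \<Rightarrow> real list" where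
  "singular_values M = sorted_list_of_multiset (image_mset sqrt (proots (char_poly (gram_mat M))))"

text \<open>
  Nothing is lost by taking only the real roots of the characteristic polynomial: the Gram matrix
  is symmetric, so that there are exactly \<open>min p q\<close> of them.
\<close>

interpretation of_real_poly_hom: map_poly_inj_idom_hom "of_real :: real \<Rightarrow> complex" ..

lemma gram_mat_carrier: "M \<in> carrier_mat p q \<Longrightarrow> gram_mat M \<in> carrier_mat (min p q) (min p q)"
  by (auto simp: gram_mat_def min_def)

lemma gram_mat_sym: "transpose_mat (gram_mat M) = gram_mat M"
  unfolding gram_mat_def by (auto simp: transpose_mult[of M "dim_row M" "dim_col M" _ "dim_row M"]
     transpose_mult[of "transpose_mat M" "dim_col M" "dim_row M" M "dim_col M"])

lemma conjugate_mult_mat_vec_real: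
  assumes S: "(S :: real mat) \<in> carrier_mat n n" and v: "v \<in> carrier_vec n"
  shows "conjugate (map_mat complex_of_real S *\<^sub>v v) = map_mat complex_of_real S *\<^sub>v conjugate v"
  using assms by (intro eq_vecI) (auto simp: scalar_prod_def)

lemma symmetric_eigenvalue_real:
  assumes S: "(S :: real mat) \<in> carrier_mat n n" and sym: "transpose_mat S = S"
    and ev: "eigenvalue (map_mat complex_of_real S) a"
  shows "a \<in> \<real>"
proof -
  let ?S = "map_mat complex_of_real S"
  from ev obtain v where v: "v \<in> carrier_vec n" "v \<noteq> 0\<^sub>v n" "?S *\<^sub>v v = a \<cdot>\<^sub>v v"
    using S unfolding eigenvalue_def eigenvector_def by auto
  have SS: "?S \<in> carrier_mat n n" using S by auto
  have tS: "transpose_mat ?S = ?S" using sym by (metis map_mat_transpose)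
  have cv: "conjugate v \<in> carrier_vec n" using v by auto
  have "a * (v \<bullet> conjugate v) = (?S *\<^sub>v v) \<bullet> conjugate v" using v cv by simp
  also have "\<dots> = conjugate v \<bullet> (?S *\<^sub>v v)" using SS v cv
    by (intro comm_scalar_prod[of _ n]) auto
  also have "\<dots> = (transpose_mat ?S *\<^sub>v conjugate v) \<bullet> v"
    using transpose_vec_mult_scalar[OF SS v(1) cv] by simp
  also have "\<dots> = conjugate (?S *\<^sub>v v) \<bullet> v" using conjugate_mult_mat_vec_real[OF S v(1)] tS by simp
  also have "\<dots> = conjugate a * (conjugate v \<bullet> v)" using v by (simp add: conjugate_smult_vec)
  also have "conjugate v \<bullet> v = v \<bullet> conjugate v" using v cv by (intro comm_scalar_prod[of _ n]) auto
  finally have "a * (v \<bullet> conjugate v) = cnj a * (v \<bullet> conjugate v)" by simp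
  moreover have "v \<bullet> conjugate v \<noteq> 0" using v(1,2) conjugate_square_eq_0_vec by blast
  ultimately show ?thesis by (metis mult_right_cancel Reals_cnj_iff)
qed

lemma length_singular_values:
  assumes M: "M \<in> carrier_mat p q"
  shows "length (singular_values M) = min p q"
proof -
  let ?G = "gram_mat M" let ?n = "min p q"
  have G: "?G \<in> carrier_mat ?n ?n" using gram_mat_carrier[OF M] .
  let ?C = "map_mat complex_of_real ?G"
  have C: "?C \<in> carrier_mat ?n ?n" using G by auto
  obtain as where as: "char_poly ?C = (\<Prod>a\<leftarrow>as. [:- a, 1:])" "length as = ?n"
    using char_poly_factorized[OF C] by blast
  have real: "a \<in> \<real>" if "a \<in> set as" for a
  proof -
    have "poly (char_poly ?C) a = 0" unfolding as(1) using that
      by (induction as) auto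
    hence "eigenvalue ?C a" using eigenvalue_root_char_poly[OF C] by simp
    from symmetric_eigenvalue_real[OF G gram_mat_sym this] show ?thesis .
  qed
  hence "map (complex_of_real \<circ> Re) as = as" by (intro map_idI) (auto simp: complex_eq_iff complex_is_Real_iff)
  then obtain bs where bs: "as = map complex_of_real bs" by (metis map_map)
  have "map_poly complex_of_real (\<Prod>b\<leftarrow>cs. [:- b, 1:]) = (\<Prod>a\<leftarrow>map complex_of_real cs. [:- a, 1:])" for cs
    by (induction cs) (simp_all add: of_real_poly_hom.hom_mult del: mult_pCons_left)
  hence "map_poly complex_of_real (char_poly ?G) = map_poly complex_of_real (\<Prod>b\<leftarrow>bs. [:- b, 1:])"
    using as(1) unfolding bs of_real_hom.char_poly_hom[OF G] by simp
  hence "char_poly ?G = (\<Prod>b\<leftarrow>bs. [:- b, 1:])" by simp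
  moreover have "proots (\<Prod>b\<leftarrow>bs. [:- b, 1:]) = mset bs"
  proof (induction bs)
    case (Cons b bs)
    have "(\<Prod>b\<leftarrow>bs. [:- b, 1:]) \<noteq> 0" by (auto simp: prod_list_zero_iff)
    thus ?case using Cons by (simp add: proots_mult del: mult_pCons_left)
  qed simp
  ultimately show ?thesis using as(2) bs unfolding singular_values_def by (simp flip: mset_map)
qed

text \<open>Singular values are numbered from 1; \<open>singular_value k M\<close> is meant for
  \<open>1 \<le> k \<le> min p q\<close> only.\<close>

definition singular_value :: "nat \<Rightarrow> real mat \<Rightarrow> real" where
  "singular_value k M = singular_values M ! (k - 1)"

text \<open>
  \<open>hankel_mat q k z i j\<close> is the Hankel matrix of depth \<open>k\<close> of \<open>z(i), \<dots>, z(j)\<close>, where the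
  \<open>z(t)\<close> have length \<open>q\<close>, for \<open>1 \<le> k \<le> j - i + 1\<close>. It has \<open>k\<close> block rows of height \<open>q\<close> and
  \<open>j - i - k + 2\<close> columns; row \<open>r\<close> is component \<open>r mod q\<close> of block row \<open>r div q\<close>.
\<close>

definition hankel_mat :: "nat \<Rightarrow> nat \<Rightarrow> (nat \<Rightarrow> real vec) \<Rightarrow> nat \<Rightarrow> nat \<Rightarrow> real mat" where
  "hankel_mat q k z i j =
     mat (k * q) (j + 2 - (i + k)) (\<lambda>(r, c). z (i + r div q + c) $ (r mod q))"

text \<open>Only the values at times \<open>0, \<dots>, T - 1\<close> of the sequences matter.\<close>

definition is_trajectory ::
  "real mat \<Rightarrow> real mat \<Rightarrow> nat \<Rightarrow> (nat \<Rightarrow> real vec) \<Rightarrow> (nat \<Rightarrow> real vec) \<Rightarrow> bool" where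
  "is_trajectory A B T u x \<longleftrightarrow>
     (\<forall>t<T. u t \<in> carrier_vec (dim_col B) \<and> x t \<in> carrier_vec (dim_row A)) \<and>
     (\<forall>t. t + 1 < T \<longrightarrow> x (t + 1) = A *\<^sub>v x t + B *\<^sub>v u t)"

text \<open>Every state can be steered to every state in finite time.\<close>

definition controllable :: "real mat \<Rightarrow> real mat \<Rightarrow> bool" where
  "controllable A B \<longleftrightarrow>
     (\<forall>x0 \<in> carrier_vec (dim_row A). \<forall>x1 \<in> carrier_vec (dim_row A).
        \<exists>N u x. is_trajectory A B (N + 1) u x \<and> x 0 = x0 \<and> x N = x1)"

text \<open>\<open>alpha\<close>-persistency of excitation of order \<open>k\<close> of \<open>u(0), \<dots>, u(T - 1)\<close>, vectors of
  length \<open>m\<close>. The bound \<open>k \<le> T\<close> says that the Hankel matrix of depth \<open>k\<close> exists.\<close>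

definition persistently_exciting ::
  "nat \<Rightarrow> real \<Rightarrow> nat \<Rightarrow> nat \<Rightarrow> (nat \<Rightarrow> real vec) \<Rightarrow> bool" where
  "persistently_exciting m \<alpha> k T u \<longleftrightarrow>
     0 < \<alpha> \<and> 1 \<le> k \<and> k \<le> T \<and> \<alpha> \<le> singular_value 1 (hankel_mat m k u 0 (T - 1))"

text \<open>The lower right block, with identity matrices on the first block superdiagonal, has an
  entry 1 exactly at the positions \<open>(r, r + m)\<close>.\<close>

definition extended_mat :: "nat \<Rightarrow> nat \<Rightarrow> real mat \<Rightarrow> real mat \<Rightarrow> real mat" where
  "extended_mat n m A B =
     four_block_mat
       A
       (mat n ((n + 1) * m) (\<lambda>(r, c). if c < m then B $$ (r, c) else 0))
       (0\<^sub>m ((n + 1) * m) n)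
       (mat ((n + 1) * m) ((n + 1) * m) (\<lambda>(r, c). if c = r + m then 1 else 0))"

definition Theta_mat :: "nat \<Rightarrow> nat \<Rightarrow> real mat \<Rightarrow> real mat \<Rightarrow> real vec \<Rightarrow> real mat" where
  "Theta_mat n m A B z =
     transpose_mat (mat_of_cols (n + (n + 1) * m)
       (map (\<lambda>i. (transpose_mat (extended_mat n m A B) ^\<^sub>m i) *\<^sub>v z) [0..<n + 1]))"

end

theory Submission
  imports Defs
begin

text \<open>
  For a matrix \<open>F\<close> that is at least as wide as high, \<open>\<sigma>\<^sub>1(F) \<ge> \<delta>\<close> says that
  \<open>\<parallel>F\<^sup>T w\<parallel> \<ge> \<delta>\<close> for all unit vectors \<open>w\<close> (lemmas \<open>le_singular_value_1_iff\<close> and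
  \<open>le_singular_value_1I\<close>). This is the variational description of the least eigenvalue of
  \<open>F F\<^sup>T\<close>, which rests on \<open>symmetric_least_eigenvalue\<close>. The lower bound on \<open>T\<close> makes the state-input
  data matrix and the input Hankel matrix \<open>H\<close> of depth \<open>n + 1\<close> wide, and \<open>\<Theta>\<^sub>z\<close> always is.

  Let \<open>w = (\<xi>, \<eta>)\<close> be a unit vector, \<open>z = (\<xi>, \<eta>, 0)\<close>, and \<open>s(t) = \<xi> \<bullet> x(t) + \<eta> \<bullet> u(t)\<close>.
  For the data matrix, \<open>\<parallel>F\<^sup>T w\<parallel>\<^sup>2\<close> is the sum of all \<open>s(t)\<^sup>2\<close>. The extended matrix \<open>M\<close> advances the
  stacked vector \<open>W(t) = (x(t), u(t), \<dots>, u(t + n))\<close> by one step, at the price of one input, so that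
  \<open>\<Theta>\<^sub>z W(t) = (s(t), \<dots>, s(t + n))\<close> (lemma \<open>Theta_mat_mult_window\<close>).

  The persistency condition controls the inputs only, so the state has to be eliminated. As \<open>\<Theta>\<^sub>z\<close> has
  \<open>n + 1\<close> rows and only \<open>n\<close> of its columns meet the state, there is a \<open>g \<noteq> 0\<close> such that
  \<open>\<Theta>\<^sub>z\<^sup>T g = (0, v)\<close> (lemma \<open>wide_mat_kernel_nontrivial\<close>). Then \<open>\<parallel>v\<parallel> = \<parallel>\<Theta>\<^sub>z\<^sup>T g\<parallel> \<ge> \<rho> \<parallel>g\<parallel>\<close>,
  and entry \<open>t\<close> of \<open>H\<^sup>T v\<close> is \<open>g \<bullet> \<Theta>\<^sub>z W(t) = g \<bullet> (s(t), \<dots>, s(t + n))\<close>. By the Cauchy-Schwarz inequality,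
  and because every \<open>s(t)\<^sup>2\<close> is counted at most \<open>n + 1\<close> times,
  \<open>\<parallel>H\<^sup>T v\<parallel>\<^sup>2 \<le> (n + 1) \<parallel>g\<parallel>\<^sup>2 \<parallel>F\<^sup>T w\<parallel>\<^sup>2\<close>. On the other side, persistency of excitation gives
  \<open>\<parallel>H\<^sup>T v\<parallel>\<^sup>2 \<ge> (\<delta>\<^sup>2 (n + 1) / \<rho>\<^sup>2) \<parallel>v\<parallel>\<^sup>2 \<ge> \<delta>\<^sup>2 (n + 1) \<parallel>g\<parallel>\<^sup>2\<close>. Cancelling \<open>(n + 1) \<parallel>g\<parallel>\<^sup>2\<close>
  leaves \<open>\<parallel>F\<^sup>T w\<parallel> \<ge> \<delta>\<close>.
\<close>

section \<open>Symmetric matrices and their least eigenvalue\<close>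

lemma scalar_prod_self_nonneg: "0 \<le> v \<bullet> (v :: real vec)"
  by (simp add: scalar_prod_def sum_nonneg)

lemma scalar_prod_self_pos:
  assumes "(v :: real vec) \<in> carrier_vec n" and "v \<noteq> 0\<^sub>v n"
  shows "0 < v \<bullet> v"
proof -
  have "v \<bullet> v \<noteq> 0" using conjugate_square_eq_0_vec[of v n] assms by simp
  with scalar_prod_self_nonneg[of v] show ?thesis by linarith
qed

text \<open>The quadratic \<open>t \<mapsto> (v + t w) \<bullet> P (v + t w)\<close> is nonnegative, hence has
  nonpositive discriminant.\<close>

lemma psd_Cauchy_Schwarz:
  assumes P: "(P :: real mat) \<in> carrier_mat n n" and sym: "transpose_mat P = P"
    and psd: "\<And>v. v \<in> carrier_vec n \<Longrightarrow> 0 \<le> v \<bullet> (P *\<^sub>v v)"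
    and v: "v \<in> carrier_vec n" and w: "w \<in> carrier_vec n"
  shows "(v \<bullet> (P *\<^sub>v w))\<^sup>2 \<le> (v \<bullet> (P *\<^sub>v v)) * (w \<bullet> (P *\<^sub>v w))"
proof -
  define a b c where "a = v \<bullet> (P *\<^sub>v v)" and "b = v \<bullet> (P *\<^sub>v w)" and "c = w \<bullet> (P *\<^sub>v w)"
  have "w \<bullet> (P *\<^sub>v v) = (transpose_mat P *\<^sub>v w) \<bullet> v"
    using transpose_vec_mult_scalar[OF P v w] by simp
  also have "\<dots> = b" unfolding sym b_def using P v w by (intro comm_scalar_prod[of _ n]) auto
  finally have b': "w \<bullet> (P *\<^sub>v v) = b" .
  have quad: "0 \<le> a + 2 * t * b + t\<^sup>2 * c" for t
  proof -
    have tw: "t \<cdot>\<^sub>v w \<in> carrier_vec n" and Pv: "P *\<^sub>v v \<in> carrier_vec n"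
      and Pw: "P *\<^sub>v w \<in> carrier_vec n" using P v w by auto
    have "0 \<le> (v + t \<cdot>\<^sub>v w) \<bullet> (P *\<^sub>v (v + t \<cdot>\<^sub>v w))" using v w by (intro psd) auto
    also have "P *\<^sub>v (v + t \<cdot>\<^sub>v w) = P *\<^sub>v v + t \<cdot>\<^sub>v (P *\<^sub>v w)"
      using mult_add_distrib_mat_vec[OF P v tw] mult_mat_vec[OF P w] by simp
    also have "(v + t \<cdot>\<^sub>v w) \<bullet> (P *\<^sub>v v + t \<cdot>\<^sub>v (P *\<^sub>v w)) = a + t * b + (t * b + t * (t * c))"
      using v w Pv Pw tw b'
      by (simp add: add_scalar_prod_distrib[of _ n] scalar_prod_add_distrib[of _ n]
           a_def b_def c_def algebra_simps)
    finally show ?thesis by (simp add: power2_eq_square algebra_simps)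
  qed
  \<comment> \<open>The discriminant argument in two steps, because \<open>c\<close> may vanish: the quadratic is evaluated at
    its minimum if \<open>c > 0\<close>, and at a point where it equals \<open>-1\<close> if \<open>c = 0\<close> and \<open>b \<noteq> 0\<close>.\<close>
  have "b\<^sup>2 \<le> a * c"
  proof (cases "c = 0")
    case True
    have "b = 0"
    proof (rule ccontr)
      assume "b \<noteq> 0"
      with quad[of "- (a + 1) / (2 * b)"] True show False by (simp add: field_simps)
    qed
    with True show ?thesis by simp
  next
    case False
    with psd[OF w] have "0 < c" unfolding c_def by simp
    with quad[of "- b / c"] show ?thesis by (simp add: power2_eq_square field_simps)
  qed
  thus ?thesis unfolding a_def b_def c_def .
qed

lemma Cauchy_Schwarz_vec:
  assumes v: "(v :: real vec) \<in> carrier_vec n" and w: "w \<in> carrier_vec n"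
  shows "(v \<bullet> w)\<^sup>2 \<le> (v \<bullet> v) * (w \<bullet> w)"
  using psd_Cauchy_Schwarz[of "1\<^sub>m n" n v w] v w scalar_prod_self_nonneg by auto

text \<open>A crude constant is enough, because it only has to exist: the absolute sum of the
  entries works, since each product \<open>\<bar>v\<^sub>i v\<^sub>j\<bar>\<close> is at most \<open>v \<bullet> v\<close>. One is added to it
  to make it positive.\<close>

lemma quadratic_form_bounded:
  assumes R: "(R :: real mat) \<in> carrier_mat n n"
  obtains C where "0 < C"
    and "\<And>v. v \<in> carrier_vec n \<Longrightarrow> \<bar>v \<bullet> (R *\<^sub>v v)\<bar> \<le> C * (v \<bullet> v)"
proof
  let ?C = "(\<Sum>i<n. \<Sum>j<n. \<bar>R $$ (i, j)\<bar>) + 1"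
  show "0 < ?C" by (intro add_nonneg_pos sum_nonneg) auto
  fix v :: "real vec" assume v: "v \<in> carrier_vec n"
  have entry: "\<bar>v $ i\<bar> \<le> sqrt (v \<bullet> v)" if "i < n" for i
  proof -
    have "v $ i * v $ i \<le> (\<Sum>j\<in>{0..<n}. v $ j * v $ j)"
      using that by (intro member_le_sum) auto
    hence "(v $ i)\<^sup>2 \<le> v \<bullet> v" using v by (simp add: scalar_prod_def power2_eq_square)
    thus ?thesis by (intro real_le_rsqrt) simp
  qed
  have entries: "\<bar>v $ i\<bar> * \<bar>v $ j\<bar> \<le> v \<bullet> v" if "i < n" "j < n" for i j
  proof -
    have "\<bar>v $ i\<bar> * \<bar>v $ j\<bar> \<le> sqrt (v \<bullet> v) * sqrt (v \<bullet> v)"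
      using entry that scalar_prod_self_nonneg[of v] by (intro mult_mono) auto
    thus ?thesis using scalar_prod_self_nonneg[of v] by simp
  qed
  have "v \<bullet> (R *\<^sub>v v) = (\<Sum>i<n. \<Sum>j<n. v $ i * (R $$ (i, j) * v $ j))"
    using R v by (simp add: scalar_prod_def sum_distrib_left atLeast0LessThan)
  also have "\<bar>\<dots>\<bar> \<le> (\<Sum>i<n. \<Sum>j<n. \<bar>v $ i * (R $$ (i, j) * v $ j)\<bar>)"
    by (rule order_trans[OF sum_abs]) (intro sum_mono sum_abs)
  also have "\<dots> \<le> (\<Sum>i<n. \<Sum>j<n. \<bar>R $$ (i, j)\<bar> * (v \<bullet> v))"
  proof (intro sum_mono)
    fix i j assume "i \<in> {..<n}" "j \<in> {..<n}"
    with entries have "\<bar>R $$ (i, j)\<bar> * (\<bar>v $ i\<bar> * \<bar>v $ j\<bar>) \<le> \<bar>R $$ (i, j)\<bar> * (v \<bullet> v)"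
      by (intro mult_left_mono) auto
    thus "\<bar>v $ i * (R $$ (i, j) * v $ j)\<bar> \<le> \<bar>R $$ (i, j)\<bar> * (v \<bullet> v)"
      by (simp add: abs_mult mult_ac)
  qed
  also have "\<dots> \<le> ?C * (v \<bullet> v)"
    using scalar_prod_self_nonneg[of v] by (simp add: sum_distrib_right distrib_right)
  finally show "\<bar>v \<bullet> (R *\<^sub>v v)\<bar> \<le> ?C * (v \<bullet> v)" .
qed

text \<open>With \<open>R = P\<^sup>-\<^sup>1\<close>, the Cauchy-Schwarz inequality for the form of \<open>P\<close>, applied to \<open>v\<close> and
  \<open>R v\<close>, gives \<open>(v \<bullet> v)\<^sup>2 \<le> (v \<bullet> P v) (v \<bullet> R v)\<close>, and the last factor is at most a constant
  times \<open>v \<bullet> v\<close>. This takes the place of compactness of the unit sphere.\<close>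

lemma psd_invertible_bounded_below:
  assumes P: "(P :: real mat) \<in> carrier_mat n n" and sym: "transpose_mat P = P"
    and psd: "\<And>v. v \<in> carrier_vec n \<Longrightarrow> 0 \<le> v \<bullet> (P *\<^sub>v v)"
    and det: "det P \<noteq> 0"
  obtains \<epsilon> where "0 < \<epsilon>" and "\<And>v. v \<in> carrier_vec n \<Longrightarrow> \<epsilon> * (v \<bullet> v) \<le> v \<bullet> (P *\<^sub>v v)"
proof -
  from det_non_zero_imp_unit[OF P det, of "()"] obtain R
    where R: "R \<in> carrier_mat n n" and PR: "P * R = 1\<^sub>m n"
    unfolding Units_def ring_mat_def by auto
  obtain C where C: "0 < C" "\<And>v. v \<in> carrier_vec n \<Longrightarrow> \<bar>v \<bullet> (R *\<^sub>v v)\<bar> \<le> C * (v \<bullet> v)"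
    using quadratic_form_bounded[OF R] by blast
  show thesis
  proof (rule that[of "1 / C"])
    fix v :: "real vec" assume v: "v \<in> carrier_vec n"
    have Rv: "R *\<^sub>v v \<in> carrier_vec n" using R v by auto
    have PRv: "P *\<^sub>v (R *\<^sub>v v) = v" using assoc_mult_mat_vec[OF P R v] PR v by simp
    have "(v \<bullet> v)\<^sup>2 \<le> (v \<bullet> (P *\<^sub>v v)) * ((R *\<^sub>v v) \<bullet> v)"
      using psd_Cauchy_Schwarz[OF P sym psd v Rv] PRv by simp
    also have "(R *\<^sub>v v) \<bullet> v = v \<bullet> (R *\<^sub>v v)" by (rule comm_scalar_prod[OF Rv v])
    also have "(v \<bullet> (P *\<^sub>v v)) * (v \<bullet> (R *\<^sub>v v)) \<le> (v \<bullet> (P *\<^sub>v v)) * (C * (v \<bullet> v))"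
      using C(2)[OF v] psd[OF v] by (intro mult_left_mono) auto
    finally have le: "(v \<bullet> v) * (v \<bullet> v) \<le> (v \<bullet> (P *\<^sub>v v)) * C * (v \<bullet> v)"
      by (simp add: power2_eq_square mult_ac)
    show "1 / C * (v \<bullet> v) \<le> v \<bullet> (P *\<^sub>v v)"
    proof (cases "v \<bullet> v = 0")
      case True
      thus ?thesis using psd[OF v] by simp
    next
      case False
      hence "0 < v \<bullet> v" using scalar_prod_self_nonneg[of v] by simp
      hence "v \<bullet> v \<le> (v \<bullet> (P *\<^sub>v v)) * C" using le by simp
      thus ?thesis using C(1) by (simp add: field_simps)
    qed
  qed (use C(1) in simp)
qed

text \<open>Let \<open>\<kappa>\<close> be the largest number with \<open>\<kappa> (v \<bullet> v) \<le> v \<bullet> S v\<close> for all \<open>v\<close>. If it were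
  not an eigenvalue, then \<open>S - \<kappa> I\<close> would be positive semidefinite and invertible, hence bounded
  below by some \<open>\<epsilon> > 0\<close>, and \<open>\<kappa> + \<epsilon>\<close> would do as well.\<close>

lemma symmetric_least_eigenvalue:
  assumes S: "(S :: real mat) \<in> carrier_mat n n" and sym: "transpose_mat S = S" and n: "0 < n"
  obtains \<kappa> where "eigenvalue S \<kappa>" and "\<And>v. v \<in> carrier_vec n \<Longrightarrow> \<kappa> * (v \<bullet> v) \<le> v \<bullet> (S *\<^sub>v v)"
proof -
  define L where "L = {\<mu>. \<forall>v \<in> carrier_vec n. \<mu> * (v \<bullet> v) \<le> v \<bullet> (S *\<^sub>v v)}"
  define \<kappa> where "\<kappa> = Sup L"
  obtain C where C: "\<And>v. v \<in> carrier_vec n \<Longrightarrow> \<bar>v \<bullet> (S *\<^sub>v v)\<bar> \<le> C * (v \<bullet> v)"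
    using quadratic_form_bounded[OF S] by blast
  have "- C \<in> L" unfolding L_def using C by fastforce
  hence ne: "L \<noteq> {}" by auto
  have le: "\<mu> \<le> (v \<bullet> (S *\<^sub>v v)) / (v \<bullet> v)"
    if "\<mu> \<in> L" "v \<in> carrier_vec n" "v \<noteq> 0\<^sub>v n" for \<mu> v
    using that scalar_prod_self_pos[OF that(2,3)] by (auto simp: L_def field_simps)
  have "unit_vec n 0 \<in> carrier_vec n" and "unit_vec n 0 \<noteq> (0\<^sub>v n :: real vec)"
    using n unit_vec_nonzero by auto
  from le[OF _ this] have bdd: "bdd_above L" by (rule bdd_aboveI)
  have low: "\<kappa> * (v \<bullet> v) \<le> v \<bullet> (S *\<^sub>v v)" if v: "v \<in> carrier_vec n" for v
  proof (cases "v = 0\<^sub>v n")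
    case True
    thus ?thesis using S by simp
  next
    case False
    have "\<kappa> \<le> (v \<bullet> (S *\<^sub>v v)) / (v \<bullet> v)"
      unfolding \<kappa>_def using ne le[OF _ v False] by (intro cSup_least)
    thus ?thesis using scalar_prod_self_pos[OF v False] by (simp add: field_simps)
  qed
  define P where "P = char_matrix S \<kappa>"
  have P: "P \<in> carrier_mat n n" unfolding P_def using S by simp
  have "S $$ (i, j) = S $$ (j, i)" if "i < n" "j < n" for i j
  proof -
    have "transpose_mat S $$ (i, j) = S $$ (j, i)" using S that by simp
    thus ?thesis unfolding sym .
  qed
  hence tP: "transpose_mat P = P"
    using S by (intro eq_matI) (auto simp: P_def char_matrix_def)
  have form: "v \<bullet> (P *\<^sub>v v) = v \<bullet> (S *\<^sub>v v) - \<kappa> * (v \<bullet> v)" if v: "v \<in> carrier_vec n" for v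
  proof -
    have "P *\<^sub>v v = S *\<^sub>v v + (- \<kappa>) \<cdot>\<^sub>v v"
      using S v by (intro eq_vecI)
        (auto simp: P_def char_matrix_def add_mult_distrib_mat_vec[of _ n n])
    thus ?thesis using S v by (simp add: scalar_prod_add_distrib[of _ n])
  qed
  have "eigenvalue S \<kappa>"
  proof (rule ccontr)
    assume "\<not> eigenvalue S \<kappa>"
    hence det: "det P \<noteq> 0" unfolding P_def using eigenvalue_det[OF S] by simp
    have psd: "0 \<le> v \<bullet> (P *\<^sub>v v)" if "v \<in> carrier_vec n" for v
      using low[OF that] form[OF that] by simp
    obtain \<epsilon> where e: "0 < \<epsilon>" "\<And>v. v \<in> carrier_vec n \<Longrightarrow> \<epsilon> * (v \<bullet> v) \<le> v \<bullet> (P *\<^sub>v v)"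
      using psd_invertible_bounded_below[OF P tP psd det] by blast
    have "\<kappa> + \<epsilon> \<in> L" unfolding L_def using e(2) form by (fastforce simp: algebra_simps)
    from cSup_upper[OF this bdd] e(1) show False unfolding \<kappa>_def by simp
  qed
  with low that show thesis by blast
qed

section \<open>The smallest singular value of a wide matrix\<close>

lemma set_singular_values:
  assumes M: "M \<in> carrier_mat p q"
  shows "set (singular_values M) = sqrt ` {a. eigenvalue (gram_mat M) a}"
proof -
  note G = gram_mat_carrier[OF M]
  have "char_poly (gram_mat M) \<noteq> 0" using degree_monic_char_poly[OF G] by auto
  thus ?thesis unfolding singular_values_def using eigenvalue_root_char_poly[OF G] by simp
qed

lemma singular_value_1_eq_Min:
  assumes M: "M \<in> carrier_mat p q" and pq: "0 < p" "0 < q"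
  shows "singular_value 1 M = Min (set (singular_values M))"
proof -
  have "singular_values M \<noteq> []" using length_singular_values[OF M] pq by auto
  moreover have "sorted (singular_values M)" by (simp add: singular_values_def)
  ultimately show ?thesis by (cases "singular_values M") (auto simp: singular_value_def intro!: Min_eqI[symmetric])
qed

text \<open>For a matrix that is at least as wide as high, the relevant Gram matrix is \<open>M M\<^sup>T\<close>, with
  \<open>v \<bullet> M M\<^sup>T v = \<parallel>M\<^sup>T v\<parallel>\<^sup>2\<close>. The bound therefore holds for all \<open>v\<close> if it holds for the
  least eigenvalue, and evaluating it at an eigenvector gives the converse.\<close>

lemma le_singular_value_1_iff:
  assumes M: "M \<in> carrier_mat p q" and p: "0 < p" "p \<le> q" and \<alpha>: "0 \<le> \<alpha>"
  shows "\<alpha> \<le> singular_value 1 M \<longleftrightarrow>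
    (\<forall>v \<in> carrier_vec p. \<alpha>\<^sup>2 * (v \<bullet> v) \<le> (transpose_mat M *\<^sub>v v) \<bullet> (transpose_mat M *\<^sub>v v))"
proof -
  let ?G = "gram_mat M"
  have Gdef: "?G = M * transpose_mat M" using M p by (simp add: gram_mat_def)
  have G: "?G \<in> carrier_mat p p" using M unfolding Gdef by auto
  have form: "(transpose_mat M *\<^sub>v v) \<bullet> (transpose_mat M *\<^sub>v v) = v \<bullet> (?G *\<^sub>v v)"
    if v: "v \<in> carrier_vec p" for v
  proof -
    have Mv: "transpose_mat M *\<^sub>v v \<in> carrier_vec q" using M v by auto
    show ?thesis unfolding transpose_vec_mult_scalar[OF M Mv v] Gdef
      using M v by (simp add: assoc_mult_mat_vec[of _ p q _ p])
  qed
  have fin: "finite (set (singular_values M))" "set (singular_values M) \<noteq> {}"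
    using length_singular_values[OF M] p by auto
  have "\<alpha> \<le> singular_value 1 M \<longleftrightarrow> (\<forall>a. eigenvalue ?G a \<longrightarrow> \<alpha> \<le> sqrt a)"
    using Min_ge_iff[OF fin] p set_singular_values[OF M] singular_value_1_eq_Min[OF M] by simp
  also have "\<dots> \<longleftrightarrow> (\<forall>v \<in> carrier_vec p. \<alpha>\<^sup>2 * (v \<bullet> v) \<le> v \<bullet> (?G *\<^sub>v v))" (is "?L \<longleftrightarrow> ?R")
  proof
    assume L: ?L
    obtain \<kappa> where l: "eigenvalue ?G \<kappa>"
      "\<And>v. v \<in> carrier_vec p \<Longrightarrow> \<kappa> * (v \<bullet> v) \<le> v \<bullet> (?G *\<^sub>v v)"
      using symmetric_least_eigenvalue[OF G gram_mat_sym p(1)] by blast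
    have "\<alpha> \<le> sqrt \<kappa>" using L l(1) by simp
    \<comment> \<open>Square roots of negative reals are negative here, so \<open>0 \<le> \<alpha> \<le> sqrt \<kappa>\<close> excludes \<open>\<kappa> < 0\<close>.\<close>
    moreover from this have "0 \<le> \<kappa>" using \<alpha> order_trans real_sqrt_ge_0_iff by blast
    ultimately have "\<alpha>\<^sup>2 \<le> \<kappa>" using \<alpha> power_mono[of \<alpha> "sqrt \<kappa>" 2] by simp
    thus ?R using l(2) scalar_prod_self_nonneg by (meson mult_right_mono order_trans)
  next
    assume R: ?R
    show ?L
    proof (intro allI impI)
      fix a assume "eigenvalue ?G a"
      then obtain v where v: "v \<in> carrier_vec p" "v \<noteq> 0\<^sub>v p" "?G *\<^sub>v v = a \<cdot>\<^sub>v v"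
        using G unfolding eigenvalue_def eigenvector_def by auto
      have "\<alpha>\<^sup>2 * (v \<bullet> v) \<le> a * (v \<bullet> v)" using R v(1,3) by fastforce
      hence "\<alpha>\<^sup>2 \<le> a" using scalar_prod_self_pos[OF v(1,2)] by simp
      thus "\<alpha> \<le> sqrt a" by (rule real_le_rsqrt)
    qed
  qed
  finally show ?thesis using form by simp
qed

lemma le_singular_value_1I:
  assumes M: "M \<in> carrier_mat p q" and p: "0 < p" "p \<le> q" and \<alpha>: "0 \<le> \<alpha>"
    and unit: "\<And>v. v \<in> carrier_vec p \<Longrightarrow> v \<bullet> v = 1 \<Longrightarrow>
      \<alpha>\<^sup>2 \<le> (transpose_mat M *\<^sub>v v) \<bullet> (transpose_mat M *\<^sub>v v)"
  shows "\<alpha> \<le> singular_value 1 M"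
  unfolding le_singular_value_1_iff[OF M p \<alpha>]
proof
  fix v :: "real vec" assume v: "v \<in> carrier_vec p"
  show "\<alpha>\<^sup>2 * (v \<bullet> v) \<le> (transpose_mat M *\<^sub>v v) \<bullet> (transpose_mat M *\<^sub>v v)"
  proof (cases "v = 0\<^sub>v p")
    case True
    thus ?thesis using scalar_prod_self_nonneg by simp
  next
    case False
    define r where "r = sqrt (v \<bullet> v)"
    have r: "0 < r" "v \<bullet> v = r\<^sup>2" using scalar_prod_self_pos[OF v False] by (simp_all add: r_def)
    let ?w = "(1 / r) \<cdot>\<^sub>v v" and ?N = "transpose_mat M"
    have Nv: "?N *\<^sub>v v \<in> carrier_vec q" and N: "?N \<in> carrier_mat q p" using M v by auto
    have "?w \<bullet> ?w = 1" using v r by (simp add: power2_eq_square)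
    hence "\<alpha>\<^sup>2 \<le> (?N *\<^sub>v ?w) \<bullet> (?N *\<^sub>v ?w)" using v by (intro unit) auto
    also have "\<dots> = ((?N *\<^sub>v v) \<bullet> (?N *\<^sub>v v)) / r\<^sup>2"
      using Nv by (simp add: mult_mat_vec[OF N v] power2_eq_square)
    finally show ?thesis using r by (simp add: field_simps)
  qed
qed

section \<open>Kernels of wide matrices and sums over windows\<close>

text \<open>Padding with zero rows makes the matrix square without changing its kernel; its transpose
  then annihilates a unit vector, so that its determinant vanishes.\<close>

lemma wide_mat_kernel_nontrivial:
  assumes K: "(K :: 'a :: field mat) \<in> carrier_mat q p" and qp: "q < p"
  obtains c where "c \<in> carrier_vec p" and "c \<noteq> 0\<^sub>v p" and "K *\<^sub>v c = 0\<^sub>v q"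
proof -
  define Q where "Q = mat p p (\<lambda>(i, j). if i < q then K $$ (i, j) else 0)"
  have Q: "Q \<in> carrier_mat p p" unfolding Q_def by simp
  have "transpose_mat Q *\<^sub>v unit_vec p q = 0\<^sub>v p"
    using qp by (intro eq_vecI) (auto simp: Q_def)
  hence "det (transpose_mat Q) = 0"
    using det_0_iff_vec_prod_zero[of "transpose_mat Q" p] Q qp unit_vec_nonzero[of q p]
    by (metis transpose_carrier_mat unit_vec_carrier)
  hence "det Q = 0" using det_transpose[OF Q] by simp
  then obtain c where c: "c \<in> carrier_vec p" "c \<noteq> 0\<^sub>v p" "Q *\<^sub>v c = 0\<^sub>v p"
    using det_0_iff_vec_prod_zero[OF Q] by auto
  have "K *\<^sub>v c = 0\<^sub>v q"
  proof (rule eq_vecI)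
    fix i assume "i < dim_vec (0\<^sub>v q :: 'a vec)"
    hence i: "i < q" by simp
    have "(K *\<^sub>v c) $ i = (Q *\<^sub>v c) $ i"
      using K c(1) i qp by (simp add: Q_def scalar_prod_def)
    thus "(K *\<^sub>v c) $ i = 0\<^sub>v q $ i" using c(3) i qp by simp
  qed (use K in simp)
  with c that show thesis by blast
qed

text \<open>Each \<open>f t\<close> lies in at most \<open>n + 1\<close> windows of length \<open>n + 1\<close>.\<close>

lemma sum_windows_le:
  fixes f :: "nat \<Rightarrow> real"
  assumes "\<And>t. 0 \<le> f t"
  shows "(\<Sum>t<T - n. \<Sum>i<n + 1. f (t + i)) \<le> real (n + 1) * (\<Sum>t<T. f t)"
proof -
  have "(\<Sum>t<T - n. \<Sum>i<n + 1. f (t + i)) = (\<Sum>i<n + 1. \<Sum>t<T - n. f (t + i))"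
    by (rule sum.swap)
  also have "\<dots> \<le> (\<Sum>i<n + 1. \<Sum>t<T. f t)"
  proof (rule sum_mono)
    fix i assume i: "i \<in> {..<n + 1}"
    have "(\<Sum>t<T - n. f (t + i)) = (\<Sum>t\<in>(\<lambda>t. t + i) ` {..<T - n}. f t)"
      by (simp add: sum.reindex)
    also have "\<dots> \<le> (\<Sum>t<T. f t)" using i assms by (intro sum_mono2) auto
    finally show "(\<Sum>t<T - n. f (t + i)) \<le> (\<Sum>t<T. f t)" .
  qed
  finally show ?thesis by simp
qed

section \<open>Action of the extended matrix on a trajectory\<close>

text \<open>The stacked vector \<open>(u(t), \<dots>, u(t + k - 1), 0, \<dots>, 0)\<close> of \<open>n + 1\<close> blocks. The zero padding
  reproduces what the shift in the extended matrix does: every multiplication moves the inputs up by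
  one block and fills the last block with zeros.\<close>

definition input_window :: "nat \<Rightarrow> nat \<Rightarrow> (nat \<Rightarrow> real vec) \<Rightarrow> nat \<Rightarrow> nat \<Rightarrow> real vec" where
  "input_window n m u t k =
     vec ((n + 1) * m) (\<lambda>r. if r div m < k then u (t + r div m) $ (r mod m) else 0)"

lemma input_window_carrier [simp]: "input_window n m u t k \<in> carrier_vec (m + n * m)"
  and dim_input_window [simp]: "dim_vec (input_window n m u t k) = m + n * m"
  by (simp_all add: input_window_def)

lemma extended_mat_carrier [simp]:
  assumes "A \<in> carrier_mat n n"
  shows "extended_mat n m A B \<in> carrier_mat (n + (m + n * m)) (n + (m + n * m))"
  using assms by (auto simp: extended_mat_def)

text \<open>The extended matrix advances time: its first block row is one step of the system, and the
  superdiagonal identities shift the remaining inputs. One input is used up, whence \<open>k + 1\<close> turns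
  into \<open>k\<close>.\<close>

lemma extended_mat_mult_window:
  assumes A: "A \<in> carrier_mat n n" and B: "B \<in> carrier_mat n m" and m: "0 < m"
    and x: "x t \<in> carrier_vec n" and u: "u t \<in> carrier_vec m"
    and step: "x (t + 1) = A *\<^sub>v x t + B *\<^sub>v u t" and k: "k \<le> n"
  shows "extended_mat n m A B *\<^sub>v (x t @\<^sub>v input_window n m u t (k + 1)) =
    x (t + 1) @\<^sub>v input_window n m u (t + 1) k"
proof -
  let ?N = "(n + 1) * m" and ?d = "input_window n m u t (k + 1)"
  let ?B = "mat n ?N (\<lambda>(r, c). if c < m then B $$ (r, c) else 0)"
  let ?D = "mat ?N ?N (\<lambda>(r, c). if c = r + m then 1 else 0 :: real)"
  have top: "?B *\<^sub>v ?d = B *\<^sub>v u t"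
  proof (rule eq_vecI)
    fix i assume "i < dim_vec (B *\<^sub>v u t)"
    hence i: "i < n" using B by simp
    have "(?B *\<^sub>v ?d) $ i = (\<Sum>c\<in>{0..<?N}. (if c < m then B $$ (i, c) else 0) * ?d $ c)"
      using i by (simp add: scalar_prod_def)
    also have "\<dots> = (\<Sum>c\<in>{0..<m}. (if c < m then B $$ (i, c) else 0) * ?d $ c)"
      by (rule sum.mono_neutral_right) auto
    also have "\<dots> = (\<Sum>c\<in>{0..<m}. B $$ (i, c) * u t $ c)"
      by (rule sum.cong) (auto simp: input_window_def)
    also have "\<dots> = (B *\<^sub>v u t) $ i" using B u i by (simp add: scalar_prod_def)
    finally show "(?B *\<^sub>v ?d) $ i = (B *\<^sub>v u t) $ i" .
  qed (use B in simp)
  have bottom: "?D *\<^sub>v ?d = input_window n m u (t + 1) k"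
  proof (rule eq_vecI)
    fix r assume "r < dim_vec (input_window n m u (t + 1) k)"
    hence r: "r < ?N" by simp
    have "(?D *\<^sub>v ?d) $ r = (\<Sum>c\<in>{0..<?N}. (if c = r + m then 1 else 0) * ?d $ c)"
      using r by (simp add: scalar_prod_def)
    also have "\<dots> = (\<Sum>c\<in>{0..<?N}. if c = r + m then ?d $ c else 0)"
      by (rule sum.cong) auto
    also have "\<dots> = (if r + m < ?N then ?d $ (r + m) else 0)" by simp
    also have "\<dots> = input_window n m u (t + 1) k $ r"
    proof (cases "r + m < ?N")
      case True
      thus ?thesis using r m by (simp add: input_window_def div_add_self2)
    next
      case False
      hence "n \<le> r div m" using m by (simp add: less_eq_div_iff_mult_less_eq)
      thus ?thesis using False r k by (simp add: input_window_def)
    qed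
    finally show "(?D *\<^sub>v ?d) $ r = input_window n m u (t + 1) k $ r" .
  qed simp
  have "extended_mat n m A B *\<^sub>v (x t @\<^sub>v ?d) =
      (A *\<^sub>v x t + ?B *\<^sub>v ?d) @\<^sub>v (0\<^sub>m ?N n *\<^sub>v x t + ?D *\<^sub>v ?d)"
    unfolding extended_mat_def using A x by (intro four_block_mat_mult_vec) auto
  also have "0\<^sub>m ?N n *\<^sub>v x t + ?D *\<^sub>v ?d = ?D *\<^sub>v ?d"
    using x by (intro eq_vecI) auto
  finally show ?thesis unfolding top bottom step .
qed

text \<open>Moving the powers of the extended matrix \<open>M\<close> over to the window turns them into time shifts.
  The induction generalizes over \<open>z\<close>: it peels off the rightmost factor of \<open>(M\<^sup>T)\<^sup>i\<^sup>+\<^sup>1\<close> and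
  applies the hypothesis to \<open>M\<^sup>T z\<close>.\<close>

lemma transpose_extended_mat_pow_window:
  assumes A: "A \<in> carrier_mat n n" and B: "B \<in> carrier_mat n m" and m: "0 < m"
    and traj: "is_trajectory A B T u x"
    and z: "z \<in> carrier_vec (n + (n + 1) * m)" and "i + k \<le> n + 1" and "t + i < T"
  shows "(transpose_mat (extended_mat n m A B) ^\<^sub>m i *\<^sub>v z) \<bullet> (x t @\<^sub>v input_window n m u t (i + k)) =
    z \<bullet> (x (t + i) @\<^sub>v input_window n m u (t + i) k)"
  using assms(5-)
proof (induction i arbitrary: z k)
  case 0
  have "extended_mat n m A B \<in> carrier_mat (n + (n + 1) * m) (n + (n + 1) * m)" using A by simp
  with 0 show ?case by simp
next
  case (Suc i)
  let ?M = "extended_mat n m A B"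
  have M: "?M \<in> carrier_mat (n + (n + 1) * m) (n + (n + 1) * m)" using A by simp
  have Mz: "transpose_mat ?M *\<^sub>v z \<in> carrier_vec (n + (n + 1) * m)" using M Suc.prems by auto
  have xu: "x (t + i) \<in> carrier_vec n" "u (t + i) \<in> carrier_vec m"
    "x (t + i + 1) = A *\<^sub>v x (t + i) + B *\<^sub>v u (t + i)"
    using traj A B Suc.prems by (auto simp: is_trajectory_def)
  let ?w = "x (t + i) @\<^sub>v input_window n m u (t + i) (k + 1)"
  have w: "?w \<in> carrier_vec (n + (n + 1) * m)" using xu by (intro append_carrier_vec) auto
  have "transpose_mat ?M ^\<^sub>m Suc i *\<^sub>v z = transpose_mat ?M ^\<^sub>m i *\<^sub>v (transpose_mat ?M *\<^sub>v z)"
    unfolding pow_mat.simps using M Suc.prems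
    by (intro assoc_mult_mat_vec[of _ "n + (n + 1) * m" "n + (n + 1) * m"] pow_carrier_mat) auto
  also have "\<dots> \<bullet> (x t @\<^sub>v input_window n m u t (i + (k + 1))) = (transpose_mat ?M *\<^sub>v z) \<bullet> ?w"
    using Suc.prems Mz by (intro Suc.IH) auto
  also have "\<dots> = z \<bullet> (?M *\<^sub>v ?w)" using M w Suc.prems by (intro transpose_vec_mult_scalar) auto
  also have "?M *\<^sub>v ?w = x (t + i + 1) @\<^sub>v input_window n m u (t + i + 1) k"
    using A B m xu Suc.prems by (intro extended_mat_mult_window) auto
  finally show ?case by simp
qed

lemma padded_scalar_prod_window:
  assumes \<xi>: "\<xi> \<in> carrier_vec n" and \<eta>: "\<eta> \<in> carrier_vec m"
    and x: "x t \<in> carrier_vec n" and u: "u t \<in> carrier_vec m" and k: "0 < k"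
  shows "(\<xi> @\<^sub>v \<eta> @\<^sub>v 0\<^sub>v (n * m)) \<bullet> (x t @\<^sub>v input_window n m u t k) = \<xi> \<bullet> x t + \<eta> \<bullet> u t"
proof -
  let ?d = "input_window n m u t k"
  have "(\<eta> @\<^sub>v 0\<^sub>v (n * m)) \<bullet> ?d = (\<Sum>r\<in>{0..<(n + 1) * m}. (if r < m then \<eta> $ r else 0) * ?d $ r)"
    using \<eta> unfolding scalar_prod_def by (intro sum.cong) auto
  also have "\<dots> = (\<Sum>r\<in>{0..<m}. (if r < m then \<eta> $ r else 0) * ?d $ r)"
    by (rule sum.mono_neutral_right) auto
  also have "\<dots> = (\<Sum>r\<in>{0..<m}. \<eta> $ r * u t $ r)"
    using k by (intro sum.cong) (auto simp: input_window_def)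
  also have "\<dots> = \<eta> \<bullet> u t" using u by (simp add: scalar_prod_def)
  finally have eq: "(\<eta> @\<^sub>v 0\<^sub>v (n * m)) \<bullet> ?d = \<eta> \<bullet> u t" .
  have "\<eta> @\<^sub>v 0\<^sub>v (n * m) \<in> carrier_vec ((n + 1) * m)" using \<eta> by auto
  thus ?thesis unfolding eq[symmetric] using \<xi> x by (intro scalar_prod_append) auto
qed

lemma Theta_mat_carrier: "Theta_mat n m A B z \<in> carrier_mat (n + 1) (n + (n + 1) * m)"
  unfolding Theta_mat_def by (simp add: mat_of_cols_def)

text \<open>Row \<open>i\<close> of \<open>\<Theta>\<^sub>z\<close> is \<open>z\<^sup>T M\<^sup>i\<close>, and \<open>M\<^sup>i\<close> shifts a full window by \<open>i\<close> steps. As \<open>i \<le> n\<close>,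
  at least one input is left, and the zero part of \<open>z\<close> hides all others: what remains
  is the scalar signal \<open>\<xi> \<bullet> x + \<eta> \<bullet> u\<close> at time \<open>t + i\<close>.\<close>

lemma Theta_mat_mult_window:
  assumes A: "A \<in> carrier_mat n n" and B: "B \<in> carrier_mat n m" and m: "0 < m"
    and traj: "is_trajectory A B T u x"
    and \<xi>: "\<xi> \<in> carrier_vec n" and \<eta>: "\<eta> \<in> carrier_vec m" and t: "t + n < T"
  shows "Theta_mat n m A B (\<xi> @\<^sub>v \<eta> @\<^sub>v 0\<^sub>v (n * m)) *\<^sub>v (x t @\<^sub>v input_window n m u t (n + 1)) =
    vec (n + 1) (\<lambda>i. \<xi> \<bullet> x (t + i) + \<eta> \<bullet> u (t + i))"
proof (rule eq_vecI)
  let ?z = "\<xi> @\<^sub>v \<eta> @\<^sub>v 0\<^sub>v (n * m)" and ?w = "x t @\<^sub>v input_window n m u t (n + 1)"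
  have "?z \<in> carrier_vec (n + (m + n * m))" using \<xi> \<eta> by (intro append_carrier_vec) auto
  hence z: "?z \<in> carrier_vec (n + (n + 1) * m)" by simp
  fix i assume "i < dim_vec (vec (n + 1) (\<lambda>i. \<xi> \<bullet> x (t + i) + \<eta> \<bullet> u (t + i)))"
  hence i: "i < n + 1" by simp
  let ?y = "transpose_mat (extended_mat n m A B) ^\<^sub>m i *\<^sub>v ?z"
  have y: "?y \<in> carrier_vec (n + (n + 1) * m)"
    using pow_carrier_mat[of "transpose_mat (extended_mat n m A B)"] extended_mat_carrier[OF A] z
    by (intro mult_mat_vec_carrier) auto
  have "row (Theta_mat n m A B ?z) i = ?y"
    unfolding Theta_mat_def using i y by (simp add: col_mat_of_cols del: upt_Suc)
  hence "(Theta_mat n m A B ?z *\<^sub>v ?w) $ i = ?y \<bullet> ?w"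
    using i Theta_mat_carrier[of n m A B ?z] by simp
  also have "\<dots> = ?z \<bullet> (x (t + i) @\<^sub>v input_window n m u (t + i) (n + 1 - i))"
    using transpose_extended_mat_pow_window[OF A B m traj z, of i "n + 1 - i" t] i t by simp
  also have "\<dots> = \<xi> \<bullet> x (t + i) + \<eta> \<bullet> u (t + i)"
    using i t traj A B \<xi> \<eta> by (intro padded_scalar_prod_window) (auto simp: is_trajectory_def)
  finally show "(Theta_mat n m A B ?z *\<^sub>v ?w) $ i =
      vec (n + 1) (\<lambda>i. \<xi> \<bullet> x (t + i) + \<eta> \<bullet> u (t + i)) $ i" using i by simp
qed (use Theta_mat_carrier in \<open>auto simp: Theta_mat_def\<close>)

section \<open>Data matrices and the lower bound\<close>

lemma hankel_mat_carrier:
  assumes "k \<le> T" "0 < T"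
  shows "hankel_mat q k w 0 (T - 1) \<in> carrier_mat (k * q) (T + 1 - k)"
  using assms by (simp add: hankel_mat_def)

lemma col_input_hankel:
  assumes "t < T - n"
  shows "col (hankel_mat m (n + 1) u 0 (T - 1)) t = input_window n m u t (n + 1)"
  using assms
  by (intro eq_vecI) (auto simp: hankel_mat_def input_window_def less_mult_imp_div_less add.commute)

lemma col_state_input_data:
  assumes x: "x t \<in> carrier_vec n" and u: "u t \<in> carrier_vec m" and t: "t < T"
  shows "col (hankel_mat n 1 x 0 (T - 1) @\<^sub>r hankel_mat m 1 u 0 (T - 1)) t = x t @\<^sub>v u t"
  using assms
  by (intro eq_vecI) (auto simp: hankel_mat_def append_rows_def)

theorem theorem3p1:
  fixes n m T :: nat and A B :: "real mat" and \<delta> \<rho> :: real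
    and u x :: "nat \<Rightarrow> real vec"
  assumes "0 < n" and "0 < m" and "0 < T"
    and "A \<in> carrier_mat n n" and "B \<in> carrier_mat n m"
    and "controllable A B"
    and "0 < \<delta>" and "0 < \<rho>"
    and "\<And>\<xi> \<eta> z. \<xi> \<in> carrier_vec n \<Longrightarrow> \<eta> \<in> carrier_vec m \<Longrightarrow> z = \<xi> @\<^sub>v \<eta> @\<^sub>v 0\<^sub>v (n * m) \<Longrightarrow>
           euclidean_norm z = 1 \<Longrightarrow> \<rho> \<le> singular_value 1 (Theta_mat n m A B z)"
    and "is_trajectory A B T u x"
    and "persistently_exciting m (\<delta> * sqrt (real (n + 1)) / \<rho>) (n + 1) T u"
    and "n + (n + 1) * m \<le> T"
  shows "\<delta> \<le> singular_value 1 (hankel_mat n 1 x 0 (T - 1) @\<^sub>r hankel_mat m 1 u 0 (T - 1))"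
proof -
  note m = assms(2) and T = assms(3) and A = assms(4) and B = assms(5)
    and traj = assms(10) and long = assms(12)
  let ?N = "(n + 1) * m" and ?\<alpha> = "\<delta> * sqrt (real (n + 1)) / \<rho>"
  let ?H = "hankel_mat m (n + 1) u 0 (T - 1)"
  let ?F = "hankel_mat n 1 x 0 (T - 1) @\<^sub>r hankel_mat m 1 u 0 (T - 1)"
  have H: "?H \<in> carrier_mat ?N (T - n)"
    using hankel_mat_carrier[of "n + 1" T m u] T long m by simp
  have F: "?F \<in> carrier_mat (n + m) T"
    using hankel_mat_carrier[of 1 T n x] hankel_mat_carrier[of 1 T m u] T by auto
  have xu: "x t \<in> carrier_vec n" "u t \<in> carrier_vec m" if "t < T" for t
    using traj A B that by (auto simp: is_trajectory_def)
  have pe: "?\<alpha> \<le> singular_value 1 ?H" using assms(11) by (simp add: persistently_exciting_def)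
  show ?thesis
  proof (rule le_singular_value_1I[OF F])
    show "0 < n + m" "n + m \<le> T" "0 \<le> \<delta>" using m long assms(7) by auto
    fix w :: "real vec" assume w: "w \<in> carrier_vec (n + m)" "w \<bullet> w = 1"
    define \<xi> \<eta> where "\<xi> = vec_first w n" and "\<eta> = vec_last w m"
    have c: "\<xi> \<in> carrier_vec n" "\<eta> \<in> carrier_vec m" and w_eq: "w = \<xi> @\<^sub>v \<eta>"
      using w by (simp_all add: \<xi>_def \<eta>_def)
    define s where "s t = \<xi> \<bullet> x t + \<eta> \<bullet> u t" for t
    have Fw: "(transpose_mat ?F *\<^sub>v w) \<bullet> (transpose_mat ?F *\<^sub>v w) = (\<Sum>t<T. (s t)\<^sup>2)"
    proof -
      have "transpose_mat ?F *\<^sub>v w = vec T s"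
      proof (rule eq_vecI)
        fix t assume "t < dim_vec (vec T s)"
        hence t: "t < T" by simp
        have "col ?F t = x t @\<^sub>v u t" using xu[OF t] t by (rule col_state_input_data)
        hence "(transpose_mat ?F *\<^sub>v w) $ t = (x t @\<^sub>v u t) \<bullet> (\<xi> @\<^sub>v \<eta>)"
          using F t by (simp flip: w_eq)
        also have "\<dots> = x t \<bullet> \<xi> + u t \<bullet> \<eta>" using xu[OF t] c by (intro scalar_prod_append) auto
        also have "\<dots> = s t" unfolding s_def
          using xu[OF t] c by (simp add: comm_scalar_prod[of "x t"] comm_scalar_prod[of "u t"])
        finally show "(transpose_mat ?F *\<^sub>v w) $ t = vec T s $ t" using t by simp
      qed (use F in simp)
      thus ?thesis by (simp add: scalar_prod_def power2_eq_square atLeast0LessThan)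
    qed

    define z where "z = \<xi> @\<^sub>v \<eta> @\<^sub>v 0\<^sub>v (n * m)"
    let ?\<Theta> = "Theta_mat n m A B z"
    have \<Theta>: "?\<Theta> \<in> carrier_mat (n + 1) (n + ?N)" by (rule Theta_mat_carrier)
    have "z \<bullet> z = \<xi> \<bullet> \<xi> + (\<eta> @\<^sub>v 0\<^sub>v (n * m)) \<bullet> (\<eta> @\<^sub>v 0\<^sub>v (n * m))"
      unfolding z_def using c by (intro scalar_prod_append[of _ n _ "m + n * m"]) auto
    also have "(\<eta> @\<^sub>v 0\<^sub>v (n * m)) \<bullet> (\<eta> @\<^sub>v 0\<^sub>v (n * m)) = \<eta> \<bullet> \<eta> + 0\<^sub>v (n * m) \<bullet> 0\<^sub>v (n * m)"
      using c by (intro scalar_prod_append[of _ m _ "n * m"]) auto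
    also have "\<xi> \<bullet> \<xi> + (\<eta> \<bullet> \<eta> + 0\<^sub>v (n * m) \<bullet> 0\<^sub>v (n * m)) = w \<bullet> w"
      unfolding w_eq using c by (simp add: scalar_prod_append[of _ n _ m])
    finally have "euclidean_norm z = 1" using w by (simp add: euclidean_norm_def)
    hence \<rho>: "\<rho> \<le> singular_value 1 ?\<Theta>" using assms(9) c z_def by blast

    \<comment> \<open>The part of \<open>\<Theta>\<^sub>z\<^sup>T\<close> that produces the \<open>n\<close> state components; a kernel vector of it yields a
      combination of the rows of \<open>\<Theta>\<^sub>z\<close> that sees inputs only.\<close>
    define K where "K = mat n (n + 1) (\<lambda>(i, j). ?\<Theta> $$ (j, i))"
    have "K \<in> carrier_mat n (n + 1)" by (simp add: K_def)
    from wide_mat_kernel_nontrivial[OF this] obtain g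
      where g: "g \<in> carrier_vec (n + 1)" "g \<noteq> 0\<^sub>v (n + 1)" "K *\<^sub>v g = 0\<^sub>v n" by auto
    define y where "y = transpose_mat ?\<Theta> *\<^sub>v g"
    have y: "y \<in> carrier_vec (n + ?N)" unfolding y_def using \<Theta> g by auto
    have "vec_first y n = K *\<^sub>v g"
      using \<Theta> g(1) by (intro eq_vecI) (auto simp: vec_first_def y_def K_def scalar_prod_def)
    define v where "v = vec_last y ?N"
    have v: "v \<in> carrier_vec ?N" by (simp add: v_def)
    have y_eq: "y = 0\<^sub>v n @\<^sub>v v"
      using vec_first_last_append[OF y] \<open>vec_first y n = K *\<^sub>v g\<close> g(3) v_def by simp

    have yy: "y \<bullet> y = v \<bullet> v"
      unfolding y_eq using v by (simp add: scalar_prod_append[of _ n _ ?N])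
    have "\<rho>\<^sup>2 * (g \<bullet> g) \<le> v \<bullet> v"
      using \<rho> g(1) le_singular_value_1_iff[OF \<Theta>, of \<rho>] assms(8) m unfolding yy[symmetric] y_def
      by simp
    hence "?\<alpha>\<^sup>2 * (\<rho>\<^sup>2 * (g \<bullet> g)) \<le> ?\<alpha>\<^sup>2 * (v \<bullet> v)" by (rule mult_left_mono) simp
    also have "\<dots> \<le> (transpose_mat ?H *\<^sub>v v) \<bullet> (transpose_mat ?H *\<^sub>v v)"
    proof -
      have "0 < ?N" "?N \<le> T - n" "0 \<le> ?\<alpha>" using m long assms(7,8) by auto
      thus ?thesis using pe v le_singular_value_1_iff[OF H, of ?\<alpha>] by blast
    qed
    also have "\<dots> = (\<Sum>t<T - n. ((transpose_mat ?H *\<^sub>v v) $ t)\<^sup>2)"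
      using H by (simp add: scalar_prod_def power2_eq_square atLeast0LessThan)
    also have "\<dots> \<le> (\<Sum>t<T - n. (g \<bullet> g) * (\<Sum>i<n + 1. (s (t + i))\<^sup>2))"
    proof (rule sum_mono)
      fix t assume "t \<in> {..<T - n}"
      hence t: "t < T - n" "t + n < T" by auto
      let ?d = "input_window n m u t (n + 1)"
      \<comment> \<open>Entry \<open>t\<close> of \<open>H\<^sup>T v\<close> is a combination, with coefficients \<open>g\<close>, of \<open>n + 1\<close> consecutive values of
        \<open>s\<close>: the zero block of \<open>(0, v)\<close> allows the state to be put on top of the inputs.\<close>
      have xd: "x t @\<^sub>v ?d \<in> carrier_vec (n + ?N)" using xu[of t] t by auto
      have "col ?H t = ?d" using t(1) by (rule col_input_hankel)
      moreover have "(transpose_mat ?H *\<^sub>v v) $ t = col ?H t \<bullet> v" using H t(1) by auto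
      ultimately have "(transpose_mat ?H *\<^sub>v v) $ t = ?d \<bullet> v" by simp
      also have "\<dots> = v \<bullet> ?d" using v by (intro comm_scalar_prod[of _ ?N]) auto
      also have "\<dots> = y \<bullet> (x t @\<^sub>v ?d)"
        unfolding y_eq using v xu[of t] t by (simp add: scalar_prod_append[of _ n _ ?N])
      also have "\<dots> = g \<bullet> (?\<Theta> *\<^sub>v (x t @\<^sub>v ?d))"
        unfolding y_def by (rule transpose_vec_mult_scalar[OF \<Theta> xd g(1)])
      also have "?\<Theta> *\<^sub>v (x t @\<^sub>v ?d) = vec (n + 1) (\<lambda>i. s (t + i))"
        unfolding z_def s_def by (rule Theta_mat_mult_window[OF A B m traj c t(2)])
      finally have "((transpose_mat ?H *\<^sub>v v) $ t)\<^sup>2 \<le>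
          (g \<bullet> g) * (vec (n + 1) (\<lambda>i. s (t + i)) \<bullet> vec (n + 1) (\<lambda>i. s (t + i)))"
        using Cauchy_Schwarz_vec[OF g(1)] by simp
      also have "vec (n + 1) (\<lambda>i. s (t + i)) \<bullet> vec (n + 1) (\<lambda>i. s (t + i)) = (\<Sum>i<n + 1. (s (t + i))\<^sup>2)"
        by (simp add: scalar_prod_def power2_eq_square atLeast0LessThan del: sum.lessThan_Suc sum.op_ivl_Suc)
      finally show "((transpose_mat ?H *\<^sub>v v) $ t)\<^sup>2 \<le> (g \<bullet> g) * (\<Sum>i<n + 1. (s (t + i))\<^sup>2)" .
    qed
    also have "\<dots> = (g \<bullet> g) * (\<Sum>t<T - n. \<Sum>i<n + 1. (s (t + i))\<^sup>2)"
      by (rule sum_distrib_left[symmetric])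
    also have "\<dots> \<le> (g \<bullet> g) * (real (n + 1) * (\<Sum>t<T. (s t)\<^sup>2))"
      using scalar_prod_self_nonneg by (intro mult_left_mono sum_windows_le) auto
    finally have "?\<alpha>\<^sup>2 * (\<rho>\<^sup>2 * (g \<bullet> g)) \<le> (g \<bullet> g) * (real (n + 1) * (\<Sum>t<T. (s t)\<^sup>2))" .
    moreover have "?\<alpha>\<^sup>2 * \<rho>\<^sup>2 = \<delta>\<^sup>2 * real (n + 1)"
      using assms(8) by (simp add: power_mult_distrib power_divide)
    ultimately have "(g \<bullet> g) * real (n + 1) * \<delta>\<^sup>2 \<le> (g \<bullet> g) * real (n + 1) * (\<Sum>t<T. (s t)\<^sup>2)"
      by (simp add: mult_ac)
    moreover have "0 < (g \<bullet> g) * real (n + 1)" using scalar_prod_self_pos[OF g(1,2)] by simp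
    ultimately show "\<delta>\<^sup>2 \<le> (transpose_mat ?F *\<^sub>v w) \<bullet> (transpose_mat ?F *\<^sub>v w)"
      unfolding Fw using mult_le_cancel_left_pos by blast
  qed
qed

end
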